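(* Let $X\ge 0$ be a random variable with distribution $F$ and let ${\bf E}[X^s]\in(0,\infty)$ for some $s\in(n,n+1)$, where $n\ge 1$ is an integer. Suppose that $\{a_k\}_{k=1}^{\infty}$ is a sequence of positive and distinct real numbers satisfying $\lim_{k\to\infty}a_k=\infty$ and $\sum_{k=1}^{\infty}1/a_k=\infty$. Then the distribution $F$ is completely determined by the sequence of translated fractional moments $$M_s^{++}=\{{\bf E}[X^s]\}\cup\{{\bf E}[(X+a_k)^s]\}_{k=1}^{\infty}\cup\{{\bf E}[(X+2a_k)^s]\}_{k=1}^{\infty}.$$ That is, if $Y\ge 0$ is a random variable with distribution $G$ such that ${\bf E}[Y^s]={\bf E}[X^s]$, ${\bf E}[(Y+a_k)^s]={\bf E}[(X+a_k)^s]$ and ${\bf E}[(Y+2a_k)^s]={\bf E}[(X+2a_k)^s]$ for all $k\ge 1$, then $G=F$.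
   Context: The distribution of a random variable $X$ is its distribution function $F(x)=\Pr(X\le x)$. "Completely determined" means determined among distributions of nonnegative random variables, with $s$ and the sequence $\{a_k\}$ given. *)

theory Defs
  imports "HOL-Probability.Probability"
begin

end

theory Submission
  imports Defs "HOL-Complex_Analysis.Complex_Analysis"
begin

text \<open>
  The translated moment \<open>\<phi>\<^sub>X(z) = E (X + z)\<^sup>s\<close> makes sense for every complex \<open>z\<close> with
  \<open>Re z > 0\<close> and is holomorphic there. The difference \<open>\<phi>\<^sub>X - \<phi>\<^sub>Y\<close> vanishes at every \<open>a\<^sub>k\<close>, and it
  grows at most like \<open>\<bar>1 + z\<bar>\<^sup>s\<close>; dividing by \<open>(1 + z)\<^sup>s\<close> gives a bounded holomorphic function on
  the right half plane. The zeros of such a function, unless it is identically zero, satisfy the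
  Blaschke condition, which for real zeros tending to infinity says \<open>\<Sum> 1/a\<^sub>k < \<infinity>\<close>. As this series
  diverges, \<open>\<phi>\<^sub>X = \<phi>\<^sub>Y\<close> (\<open>bounded_holomorphic_half_plane_eq_0\<close>,
  \<open>moment_eq_of_moment_at_sequence\<close>).

  Differentiation in \<open>z\<close> lowers the exponent: \<open>d/dz E (X + z)\<^sup>\<beta> = \<beta> E (X + z)\<^bsup>\<beta>-1\<^esup>\<close>. Since \<open>s\<close>
  is not an integer, the factor \<open>\<beta> = s - m\<close> never vanishes, and so \<open>X\<close> and \<open>Y\<close> share the moments
  \<open>E (1 + X)\<^bsup>s-m\<^esup>\<close> for all natural \<open>m\<close> (\<open>moment_eq_minus_nat\<close>). With \<open>U = 1/(1 + X)\<close>, a variable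
  with values in \<open>[0,1]\<close>, these are the power moments of \<open>U\<close> under the finite measure with density
  \<open>(1 + X)\<^sup>s\<close>. A Hausdorff moment problem is determinate by Weierstrass approximation, and
  the density cancels against the continuous function \<open>u\<^sup>s\<close>; this recovers the law of \<open>U\<close>,
  hence that of \<open>X\<close> (\<open>cdf_eq_of_power_moments\<close>).
\<close>

section \<open>Zeros of bounded holomorphic functions on the right half plane\<close>

lemma cmod_diff_eq_cmod_add:
  "(cmod (z - of_real a))\<^sup>2 = (cmod (z + of_real a))\<^sup>2 - 4 * a * Re z"
  unfolding cmod_power2 by (simp add: power2_eq_square algebra_simps)

text \<open>
  The Cayley map \<open>w \<mapsto> a (1 + w) / (1 - w)\<close> carries the unit disc onto the half plane and \<open>0\<close> to \<open>a\<close>,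
  so this is the Schwarz lemma for the disc. The form without quotients also covers \<open>z = a\<close>.
\<close>

lemma half_plane_Schwarz:
  fixes a :: real
  assumes holf: "f holomorphic_on {z. 0 < Re z}"
    and bound: "\<And>z. 0 < Re z \<Longrightarrow> cmod (f z) \<le> C"
    and "0 < a" and zero: "f (of_real a) = 0" and z: "0 < Re z"
  shows "cmod (f z) * cmod (z + of_real a) \<le> C * cmod (z - of_real a)"
proof -
  define q where "q = (\<lambda>w::complex. of_real a * ((1 + w) / (1 - w)))"
  have q_pos: "0 < Re (q w)" if "cmod w < 1" for w
  proof -
    have "w \<noteq> 1" using that by auto
    have "Re ((1 + w) * cnj (1 - w)) = 1 - (cmod w)\<^sup>2"
      unfolding cmod_power2 by (simp add: power2_eq_square algebra_simps)
    also have "\<dots> > 0"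
      using that by (simp add: abs_square_less_1)
    finally have "0 < Re ((1 + w) * cnj (1 - w)) / (cmod (1 - w))\<^sup>2"
      using \<open>w \<noteq> 1\<close> by simp
    then have "0 < Re ((1 + w) / (1 - w))"
      by (subst complex_div_cnj) (simp del: complex_cnj_diff flip: of_real_power)
    from mult_pos_pos[OF \<open>0 < a\<close> this] show ?thesis
      by (simp only: q_def times_complex.sel Re_complex_of_real Im_complex_of_real
          mult_zero_left diff_zero)
  qed
  have holq: "q holomorphic_on ball 0 1"
    unfolding q_def by (intro holomorphic_intros) auto
  have holh: "(f \<circ> q) holomorphic_on ball 0 1"
    by (rule holomorphic_on_compose_gen[OF holq holf]) (use q_pos in auto)
  define w where "w = (z - of_real a) / (z + of_real a)"
  have za: "z + of_real a \<noteq> 0"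
    using z \<open>0 < a\<close> by (auto simp: complex_eq_iff)
  have "(cmod (z - of_real a))\<^sup>2 < (cmod (z + of_real a))\<^sup>2"
    using z \<open>0 < a\<close> by (simp add: cmod_diff_eq_cmod_add)
  then have "cmod (z - of_real a) < cmod (z + of_real a)"
    by (rule power_less_imp_less_base) simp
  then have w: "cmod w < 1"
    using za by (simp add: w_def norm_divide)
  have "1 + w = 2 * z / (z + of_real a)" "1 - w = 2 * of_real a / (z + of_real a)"
    using za by (simp_all add: w_def field_simps)
  then have qw: "q w = z"
    using za \<open>0 < a\<close> by (simp add: q_def)
  \<comment> \<open>The Schwarz lemma asks for values strictly inside the disc: scale by \<open>D > C\<close>, then let \<open>D\<close> tend
      to \<open>C\<close>.\<close>
  have "cmod (f z) * cmod (z + of_real a) \<le> D * cmod (z - of_real a)" if "C < D" for D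
  proof -
    have "0 < D" using bound[OF z] norm_ge_zero[of "f z"] that by linarith
    define h where "h = (\<lambda>u. f (q u) / of_real D)"
    have "h holomorphic_on ball 0 1"
      using holh \<open>0 < D\<close> unfolding h_def comp_def by (intro holomorphic_intros) auto
    moreover have "h 0 = 0" using zero by (simp add: h_def q_def)
    moreover have "cmod (h u) < 1" if "cmod u < 1" for u
      using bound[OF q_pos[OF that]] \<open>C < D\<close> \<open>0 < D\<close> by (simp add: h_def norm_divide)
    ultimately have "cmod (h w) \<le> cmod w"
      by (rule Schwarz_Lemma(1)[OF _ _ _ w]) 
    then show ?thesis
      using za \<open>0 < D\<close> by (simp add: h_def qw norm_divide) (simp add: w_def norm_divide field_simps)
  qed
  then have "\<forall>\<^sub>F D in at_right C. cmod (f z) * cmod (z + of_real a) \<le> D * cmod (z - of_real a)"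
    by (auto intro: eventually_mono[OF eventually_at_right_less])
  moreover have "((\<lambda>D. D * cmod (z - of_real a)) \<longlongrightarrow> C * cmod (z - of_real a)) (at_right C)"
    by (intro tendsto_intros)
  ultimately show ?thesis
    by (intro tendsto_lowerbound) auto
qed

text \<open>
  Dividing out a zero does not increase the bound. This is what allows zeros to be removed one
  after the other.
\<close>

lemma half_plane_divide_Blaschke_factor:
  fixes a :: real
  assumes holf: "f holomorphic_on {z. 0 < Re z}"
    and bound: "\<And>z. 0 < Re z \<Longrightarrow> cmod (f z) \<le> C"
    and "0 < a" and zero: "f (of_real a) = 0"
  obtains g where "g holomorphic_on {z. 0 < Re z}"
    and "\<And>z. 0 < Re z \<Longrightarrow> cmod (g z) \<le> C"
    and "\<And>z. 0 < Re z \<Longrightarrow> f z = g z * ((z - of_real a) / (z + of_real a))"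
proof
  let ?H = "{z. 0 < Re z}"
  define g where "g = (\<lambda>z. (z + of_real a) *
      (if z = of_real a then deriv f (of_real a) else (f z - f (of_real a)) / (z - of_real a)))"
  have opH: "open ?H" by (rule open_halfspace_Re_gt)
  have ne: "z + of_real a \<noteq> 0" if "0 < Re z" for z
    using that \<open>0 < a\<close> by (auto simp: complex_eq_iff)
  show holg: "g holomorphic_on ?H"
    unfolding g_def using \<open>0 < a\<close> opH
    by (intro holomorphic_on_mult holomorphic_intros pole_lemma[OF holf]) (simp add: interior_open)
  show "f z = g z * ((z - of_real a) / (z + of_real a))" if "0 < Re z" for z
    using ne[OF that] zero by (simp add: g_def)
  have off: "cmod (g z) \<le> C" if "0 < Re z" "z \<noteq> of_real a" for z
  proof -
    have "cmod (g z) = cmod (f z) * cmod (z + of_real a) / cmod (z - of_real a)"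
      using that zero by (simp add: g_def norm_mult norm_divide)
    then show ?thesis
      using half_plane_Schwarz[OF holf bound \<open>0 < a\<close> zero that(1)] that
      by (simp add: divide_le_eq)
  qed
  \<comment> \<open>The Schwarz lemma gives nothing for the removed singularity; there the bound follows by
      continuity.\<close>
  have "continuous_on ?H g" using holg by (rule holomorphic_on_imp_continuous_on)
  then have "(g \<longlongrightarrow> g (of_real a)) (at (of_real a))"
    using opH \<open>0 < a\<close> by (simp add: continuous_on_eq_continuous_at isCont_def)
  moreover have "\<forall>\<^sub>F z in at (of_real a). cmod (g z) \<le> C"
    using off opH \<open>0 < a\<close> by (auto simp: eventually_at_topological)
  ultimately have at_a: "cmod (g (of_real a)) \<le> C"
    by (intro Lim_norm_ubound[of "at (of_real a)" g]) auto
  show "cmod (g z) \<le> C" if "0 < Re z" for z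
    using off[OF that] at_a by (cases "z = of_real a") auto
qed

lemma half_plane_Blaschke_bound:
  fixes A :: "real set"
  assumes "finite A" "A \<subseteq> {0<..}"
    and "f holomorphic_on {z. 0 < Re z}"
    and "\<And>z. 0 < Re z \<Longrightarrow> cmod (f z) \<le> C"
    and "\<And>a. a \<in> A \<Longrightarrow> f (of_real a) = 0"
    and z: "0 < Re z"
  shows "cmod (f z) \<le> C * (\<Prod>a\<in>A. cmod ((z - of_real a) / (z + of_real a)))"
  using assms(1-5)
proof (induction A arbitrary: f rule: finite_induct)
  case empty
  then show ?case using z by simp
next
  case (insert a A)
  then have "0 < a" "f (of_real a) = 0" by auto
  then obtain g where g: "g holomorphic_on {z. 0 < Re z}"
    "\<And>z. 0 < Re z \<Longrightarrow> cmod (g z) \<le> C"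
    "\<And>z. 0 < Re z \<Longrightarrow> f z = g z * ((z - of_real a) / (z + of_real a))"
    using half_plane_divide_Blaschke_factor[OF insert.prems(2,3)] by metis
  have "g (of_real b) = 0" if "b \<in> A" for b
  proof -
    have "b \<noteq> a" "0 < b" "f (of_real b) = 0" using that insert by auto
    then show ?thesis
      using g(3)[of "of_real b"] \<open>0 < a\<close> by (auto simp flip: of_real_add of_real_diff)
  qed
  then have "cmod (g z) \<le> C * (\<Prod>a\<in>A. cmod ((z - of_real a) / (z + of_real a)))"
    using insert.prems(1) g by (intro insert.IH) auto
  then have "cmod (g z) * cmod ((z - of_real a) / (z + of_real a))
      \<le> (C * (\<Prod>a\<in>A. cmod ((z - of_real a) / (z + of_real a)))) * cmod ((z - of_real a) / (z + of_real a))"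
    by (rule mult_right_mono) simp
  then show ?case
    by (simp only: prod.insert[OF insert.hyps] g(3)[OF z] norm_mult mult_ac)
qed

text \<open>
  From \<open>\<bar>z - a\<bar>\<^sup>2 / \<bar>z + a\<bar>\<^sup>2 = 1 - 4 a Re z / \<bar>z + a\<bar>\<^sup>2\<close> and \<open>\<bar>z + a\<bar> \<le> 2 a\<close>. The bound turns
  divergence of \<open>\<Sum> 1/a\<^sub>k\<close> into convergence of the Blaschke product to \<open>0\<close>.
\<close>

lemma Blaschke_factor_le_exp:
  fixes a :: real
  assumes "0 < Re z" "cmod z \<le> a"
  shows "cmod ((z - of_real a) / (z + of_real a)) \<le> exp (- (Re z / (2 * a)))"
proof -
  have "0 < a" using assms complex_Re_le_cmod[of z] by linarith
  have ne: "0 < cmod (z + of_real a)"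
    using assms(1) \<open>0 < a\<close> by (auto simp: complex_eq_iff)
  have "cmod (z + of_real a) \<le> 2 * a"
    using norm_triangle_ineq[of z "of_real a"] assms(2) \<open>0 < a\<close> by simp
  then have "(cmod (z + of_real a))\<^sup>2 \<le> (2 * a)\<^sup>2"
    by (rule power_mono) simp
  then have "4 * a * Re z / (2 * a)\<^sup>2 \<le> 4 * a * Re z / (cmod (z + of_real a))\<^sup>2"
    using assms(1) \<open>0 < a\<close> ne by (intro divide_left_mono) auto
  moreover have "4 * a * Re z / (2 * a)\<^sup>2 = Re z / a"
    using \<open>0 < a\<close> by (simp add: power2_eq_square field_simps)
  moreover have "(cmod ((z - of_real a) / (z + of_real a)))\<^sup>2
      = 1 - 4 * a * Re z / (cmod (z + of_real a))\<^sup>2"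
    using ne unfolding norm_divide power_divide cmod_diff_eq_cmod_add by (simp add: diff_divide_distrib)
  ultimately have "(cmod ((z - of_real a) / (z + of_real a)))\<^sup>2 \<le> 1 + (- (Re z / a))"
    by linarith
  also have "\<dots> \<le> exp (- (Re z / a))" by (rule exp_ge_add_one_self)
  also have "\<dots> = (exp (- (Re z / (2 * a))))\<^sup>2"
    by (simp flip: exp_double)
  finally show ?thesis by (rule power2_le_imp_le) simp
qed

text \<open>
  By \<open>half_plane_Blaschke_bound\<close>, \<open>\<bar>f z\<bar>\<close> is at most \<open>C\<close> times every finite Blaschke product over the
  zeros. Only the zeros from some index \<open>K\<close> on are used, because \<open>Blaschke_factor_le_exp\<close> applies to
  zeros \<open>a\<^sub>k \<ge> \<bar>z\<bar>\<close>.
\<close>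

lemma bounded_holomorphic_half_plane_eq_0:
  fixes a :: "nat \<Rightarrow> real"
  assumes holf: "f holomorphic_on {z. 0 < Re z}"
    and bound: "\<And>z. 0 < Re z \<Longrightarrow> cmod (f z) \<le> C"
    and pos: "\<And>k. 1 \<le> k \<Longrightarrow> 0 < a k" and inj: "inj_on a {1..}"
    and lim: "filterlim a at_top sequentially"
    and div: "filterlim (\<lambda>m. \<Sum>k=1..m. 1 / a k) at_top sequentially"
    and zero: "\<And>k. 1 \<le> k \<Longrightarrow> f (of_real (a k)) = 0"
    and z: "0 < Re z"
  shows "f z = 0"
proof -
  have "0 \<le> C" using bound[OF z] norm_ge_zero order_trans by blast
  obtain K where K: "\<And>k. K \<le> k \<Longrightarrow> cmod z \<le> a k"
    using lim by (auto simp: filterlim_at_top eventually_sequentially)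
  define S where "S = (\<lambda>m. \<Sum>k=1..m. 1 / a k)"
  have le: "cmod (f z) \<le> C * exp (- (Re z / 2 * (S m - S K)))" if "K \<le> m" for m
  proof -
    let ?F = "\<lambda>a::real. cmod ((z - of_real a) / (z + of_real a))"
    have inj': "inj_on a {K<..m}" by (rule inj_on_subset[OF inj]) auto
    have "cmod (f z) \<le> C * (\<Prod>b\<in>a ` {K<..m}. ?F b)"
      using pos zero by (intro half_plane_Blaschke_bound holf bound z) auto
    also have "(\<Prod>b\<in>a ` {K<..m}. ?F b) = (\<Prod>k\<in>{K<..m}. ?F (a k))"
      by (simp add: prod.reindex[OF inj'])
    also have "\<dots> \<le> (\<Prod>k\<in>{K<..m}. exp (- (Re z / (2 * a k))))"
      using K z by (intro prod_mono conjI Blaschke_factor_le_exp) auto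
    also have "\<dots> = exp (- (Re z / 2 * (\<Sum>k\<in>{K<..m}. 1 / a k)))"
      by (simp add: exp_sum sum_distrib_left flip: sum_negf)
    also have "(\<Sum>k\<in>{K<..m}. 1 / a k) = S m - S K"
    proof -
      have "{1..m} = {1..K} \<union> {K<..m}" using that by auto
      then have "S m = S K + (\<Sum>k\<in>{K<..m}. 1 / a k)"
        unfolding S_def by (simp only:) (rule sum.union_disjoint; auto)
      then show ?thesis by simp
    qed
    finally show ?thesis using \<open>0 \<le> C\<close> by (simp add: mult_left_mono)
  qed
  have "filterlim (\<lambda>m. Re z / 2 * (- S K + S m)) at_top sequentially"
    using z div unfolding S_def
    by (intro filterlim_tendsto_pos_mult_at_top[OF tendsto_const]
        filterlim_tendsto_add_at_top[OF tendsto_const]) auto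
  then have "filterlim (\<lambda>m. - (Re z / 2 * (- S K + S m))) at_bot sequentially"
    by (simp only: filterlim_uminus_at_bot minus_minus)
  then have "(\<lambda>m. C * exp (- (Re z / 2 * (- S K + S m)))) \<longlonglongrightarrow> C * 0"
    by (intro tendsto_mult tendsto_const filterlim_compose[OF exp_at_bot])
  then have "cmod (f z) \<le> C * 0"
    using le by (intro tendsto_lowerbound[of _ _ sequentially]) (auto simp: eventually_sequentially)
  then show ?thesis by simp
qed


section \<open>Translated moments as holomorphic functions\<close>

text \<open>
  With \<open>t = \<bar>x + w\<bar>\<close> one has \<open>r \<le> t \<le> K (1 + x)\<close>: the first term covers negative exponents, the second
  covers nonnegative ones. The bound is uniform in \<open>w\<close>, so it serves as dominating function
  for \<open>x + w\<close> with \<open>w\<close> ranging over a ball.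
\<close>

lemma cmod_shifted_powr_le:
  assumes x: "0 \<le> x" and r: "0 < r" "r \<le> Re w" and K: "cmod w \<le> K" "1 \<le> K"
    and \<gamma>: "\<gamma> \<le> s" "0 \<le> s"
  shows "cmod ((of_real x + w) powr of_real \<gamma>) \<le> r powr \<gamma> + K powr s * (1 + x) powr s"
proof -
  define t where "t = cmod (of_real x + w)"
  have "r \<le> Re (of_real x + w)" using x r by simp
  then have rt: "r \<le> t" unfolding t_def using complex_Re_le_cmod order_trans by blast
  have "t \<le> x + cmod w" unfolding t_def using norm_triangle_ineq[of "of_real x" w] x by simp
  also have "\<dots> \<le> 1 * x + K * 1" using K by simp
  also have "\<dots> \<le> K * x + K * 1" using K x by (intro add_mono mult_right_mono) auto
  finally have tK: "t \<le> K * (1 + x)" by (simp add: algebra_simps)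
  have "1 * 1 \<le> K * (1 + x)" using K x by (intro mult_mono) auto
  then have one: "1 \<le> K * (1 + x)" by simp
  have "t powr \<gamma> \<le> r powr \<gamma> + (K * (1 + x)) powr s"
  proof (cases "0 \<le> \<gamma>")
    case True
    have "t powr \<gamma> \<le> (K * (1 + x)) powr \<gamma>"
      using True tK rt r by (intro powr_mono2) auto
    also have "\<dots> \<le> (K * (1 + x)) powr s"
      using one \<gamma> by (intro powr_mono) auto
    also have "\<dots> \<le> r powr \<gamma> + (K * (1 + x)) powr s" by simp
    finally show ?thesis .
  next
    case False
    then have "t powr \<gamma> \<le> r powr \<gamma>"
      using rt r by (intro powr_mono2') auto
    moreover have "0 \<le> (K * (1 + x)) powr s" by simp
    ultimately show ?thesis by linarith
  qed
  also have "(K * (1 + x)) powr s = K powr s * (1 + x) powr s"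
    using K x by (simp add: powr_mult)
  finally show ?thesis
    by (simp add: t_def norm_powr_real_powr')
qed

text \<open>
  Integrability is stated for \<open>(1 + X)\<^sup>s\<close> instead of \<open>X\<^sup>s\<close> because \<open>1 + X\<close> stays away from zero: up to
  constants, \<open>(1 + X)\<^sup>s\<close> then dominates all powers \<open>\<bar>X + z\<bar>\<^sup>\<beta>\<close> with \<open>\<beta> \<le> s\<close>, negative ones included.
\<close>

locale nonneg_power_moment = prob_space M for M :: "'a measure" +
  fixes X :: "'a \<Rightarrow> real" and s :: real
  assumes X_measurable [measurable]: "X \<in> borel_measurable M"
    and X_nonneg: "AE \<omega> in M. 0 \<le> X \<omega>"
    and s_pos: "0 < s"
    and integrable_1_plus_X: "integrable M (\<lambda>\<omega>. (1 + X \<omega>) powr s)"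
begin

definition moment :: "real \<Rightarrow> complex \<Rightarrow> complex" where
  "moment \<beta> z = (\<integral>\<omega>. (of_real (X \<omega>) + z) powr of_real \<beta> \<partial>M)"

lemma integrable_shifted_powr:
  assumes "0 < Re z" "\<beta> \<le> s"
  shows "integrable M (\<lambda>\<omega>. (of_real (X \<omega>) + z) powr of_real \<beta> :: complex)"
proof (rule Bochner_Integration.integrable_bound)
  show "integrable M (\<lambda>\<omega>. Re z powr \<beta> + (1 + cmod z) powr s * (1 + X \<omega>) powr s)"
    using integrable_1_plus_X by simp
  show "AE \<omega> in M. cmod ((of_real (X \<omega>) + z) powr of_real \<beta>)
      \<le> norm (Re z powr \<beta> + (1 + cmod z) powr s * (1 + X \<omega>) powr s)"
    using X_nonneg
  proof eventually_elim
    case (elim \<omega>)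
    then show ?case
      using cmod_shifted_powr_le[of "X \<omega>" "Re z" z "1 + cmod z" \<beta> s] assms s_pos by simp
  qed
qed measurable

text \<open>
  Differentiation under the integral sign. By the mean value inequality the difference quotients
  \<open>q w\<close> for \<open>w\<close> in the ball of radius \<open>Re z / 2\<close> around \<open>z\<close> are bounded by the supremum of the
  derivative on that ball, to which \<open>cmod_shifted_powr_le\<close> applies.
\<close>

lemma has_field_derivative_moment:
  assumes z: "0 < Re z" and "\<beta> \<le> s"
  shows "(moment \<beta> has_field_derivative of_real \<beta> * moment (\<beta> - 1) z) (at z)"
proof -
  define r where "r = Re z / 2"
  define K where "K = 1 + cmod z + r"
  define B where "B = (\<lambda>x. \<bar>\<beta>\<bar> * (r powr (\<beta> - 1) + K powr s * (1 + x) powr s))"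
  define q where "q = (\<lambda>w \<omega>. ((of_real (X \<omega>) + w) powr of_real \<beta>
      - (of_real (X \<omega>) + z) powr of_real \<beta>) / (w - z))"
  have r: "0 < r" using z by (simp add: r_def)
  have ball_Re: "r \<le> Re w" and ball_cmod: "cmod w \<le> K" if "w \<in> ball z r" for w
  proof -
    have *: "cmod (w - z) < r" using that by (simp add: dist_norm norm_minus_commute)
    have "\<bar>Re (w - z)\<bar> \<le> cmod (w - z)" by (rule abs_Re_le_cmod)
    with * show "r \<le> Re w" by (simp add: r_def)
    have "cmod w \<le> cmod (w - z) + cmod z" using norm_triangle_ineq[of "w - z" z] by simp
    with * show "cmod w \<le> K" by (simp add: K_def)
  qed
  have deriv: "((\<lambda>w. (of_real x + w) powr of_real \<beta>)
      has_field_derivative of_real \<beta> * (of_real x + w) powr of_real (\<beta> - 1)) (at w)"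
    if "0 \<le> x" "w \<in> ball z r" for x w
  proof -
    have "of_real x + w \<notin> \<real>\<^sub>\<le>\<^sub>0"
      using that ball_Re[OF that(2)] r by (auto simp: complex_nonpos_Reals_iff)
    then show ?thesis by (auto intro!: derivative_eq_intros)
  qed
  have bound: "cmod (q w \<omega>) \<le> B (X \<omega>)" if "0 \<le> X \<omega>" "w \<in> ball z r - {z}" for w \<omega>
  proof -
    have "cmod ((of_real (X \<omega>) + w) powr of_real \<beta> - (of_real (X \<omega>) + z) powr of_real \<beta>)
        \<le> B (X \<omega>) * cmod (w - z)"
    proof (rule field_differentiable_bound[OF convex_ball])
      fix v assume v: "v \<in> ball z r"
      show "((\<lambda>w. (of_real (X \<omega>) + w) powr of_real \<beta>) has_field_derivative
          of_real \<beta> * (of_real (X \<omega>) + v) powr of_real (\<beta> - 1)) (at v within ball z r)"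
        using deriv[OF that(1) v] by (rule has_field_derivative_at_within)
      show "cmod (of_real \<beta> * (of_real (X \<omega>) + v) powr of_real (\<beta> - 1)) \<le> B (X \<omega>)"
        unfolding B_def norm_mult norm_of_real
        using that(1) r ball_Re[OF v] ball_cmod[OF v] \<open>\<beta> \<le> s\<close> s_pos
        by (intro mult_left_mono cmod_shifted_powr_le) (auto simp: K_def)
    qed (use that r in auto)
    then show ?thesis
      using that(2) by (simp add: q_def norm_divide divide_le_eq)
  qed
  have "((\<lambda>w. (moment \<beta> w - moment \<beta> z) / (w - z)) \<longlongrightarrow> of_real \<beta> * moment (\<beta> - 1) z)
      (at z within ball z r)"
    unfolding tendsto_at_iff_sequentially comp_def
  proof (intro allI impI)
    fix Z :: "nat \<Rightarrow> complex"
    assume Z: "\<forall>i. Z i \<in> ball z r - {z}" and lim: "Z \<longlonglongrightarrow> z"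
    have "(moment \<beta> (Z i) - moment \<beta> z) / (Z i - z) = (\<integral>\<omega>. q (Z i) \<omega> \<partial>M)" for i
    proof -
      have "0 < Re (Z i)" using ball_Re[of "Z i"] Z r by force
      then show ?thesis
        using integrable_shifted_powr[of _ \<beta>] z \<open>\<beta> \<le> s\<close>
        by (simp add: moment_def q_def)
    qed
    moreover have "(\<lambda>i. \<integral>\<omega>. q (Z i) \<omega> \<partial>M)
        \<longlonglongrightarrow> (\<integral>\<omega>. of_real \<beta> * (of_real (X \<omega>) + z) powr of_real (\<beta> - 1) \<partial>M)"
    proof (rule integral_dominated_convergence[where w = "\<lambda>\<omega>. B (X \<omega>)"])
      show "integrable M (\<lambda>\<omega>. B (X \<omega>))"
        using integrable_1_plus_X by (simp add: B_def)
      show "AE \<omega> in M. cmod (q (Z i) \<omega>) \<le> B (X \<omega>)" for i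
        using X_nonneg by eventually_elim (use bound Z in auto)
      show "AE \<omega> in M. (\<lambda>i. q (Z i) \<omega>)
          \<longlonglongrightarrow> of_real \<beta> * (of_real (X \<omega>) + z) powr of_real (\<beta> - 1)"
        using X_nonneg
      proof eventually_elim
        case (elim \<omega>)
        have "((\<lambda>w. q w \<omega>) \<longlongrightarrow> of_real \<beta> * (of_real (X \<omega>) + z) powr of_real (\<beta> - 1)) (at z)"
          using deriv[OF elim, of z] r unfolding has_field_derivative_iff q_def by simp
        then show ?case
          using Z lim unfolding tendsto_at_iff_sequentially comp_def by auto
      qed
    qed (simp_all add: q_def)
    ultimately show "(\<lambda>i. (moment \<beta> (Z i) - moment \<beta> z) / (Z i - z))
        \<longlonglongrightarrow> of_real \<beta> * moment (\<beta> - 1) z"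
      by (simp add: moment_def)
  qed
  then show ?thesis
    using r by (simp add: has_field_derivative_iff at_within_open[of z "ball z r"])
qed

lemma holomorphic_on_moment:
  assumes "\<beta> \<le> s"
  shows "moment \<beta> holomorphic_on {z. 0 < Re z}"
  using has_field_derivative_moment[OF _ assms]
  by (auto simp: holomorphic_on_open[OF open_halfspace_Re_gt])

lemma moment_of_real:
  assumes "0 < b"
  shows "moment \<beta> (of_real b) = of_real (\<integral>\<omega>. (X \<omega> + b) powr \<beta> \<partial>M)"
proof -
  have "moment \<beta> (of_real b) = (\<integral>\<omega>. complex_of_real ((X \<omega> + b) powr \<beta>) \<partial>M)"
    unfolding moment_def
  proof (rule integral_cong_AE)
    show "AE \<omega> in M. (complex_of_real (X \<omega>) + of_real b) powr of_real \<beta> = of_real ((X \<omega> + b) powr \<beta>)"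
      using X_nonneg by eventually_elim (use assms in \<open>simp flip: of_real_add powr_of_real\<close>)
  qed measurable
  then show ?thesis by simp
qed

text \<open>
  Both \<open>1\<close> and \<open>\<bar>z\<bar>\<close> are at most \<open>\<bar>1 + z\<bar>\<close> on the half plane, hence \<open>\<bar>X + z\<bar> \<le> \<bar>1 + z\<bar> (1 + X)\<close>.
\<close>

lemma cmod_moment_le:
  assumes z: "0 < Re z"
  shows "cmod (moment s z) \<le> cmod (1 + z) powr s * (\<integral>\<omega>. (1 + X \<omega>) powr s \<partial>M)"
proof -
  have "cmod (moment s z) \<le> (\<integral>\<omega>. cmod ((of_real (X \<omega>) + z) powr of_real s) \<partial>M)"
    unfolding moment_def by (rule integral_norm_bound)
  also have "\<dots> \<le> (\<integral>\<omega>. cmod (1 + z) powr s * (1 + X \<omega>) powr s \<partial>M)"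
  proof (rule integral_mono_AE)
    show "AE \<omega> in M. cmod ((of_real (X \<omega>) + z) powr of_real s)
        \<le> cmod (1 + z) powr s * (1 + X \<omega>) powr s"
      using X_nonneg
    proof eventually_elim
      case (elim \<omega>)
      have "1 \<le> Re (1 + z)" using z by simp
      then have 1: "1 \<le> cmod (1 + z)" using complex_Re_le_cmod order_trans by blast
      have "(cmod z)\<^sup>2 \<le> (cmod (1 + z))\<^sup>2"
        unfolding cmod_power2 using z by (simp add: power2_eq_square algebra_simps)
      then have 2: "cmod z \<le> cmod (1 + z)" by (rule power2_le_imp_le) simp
      have "cmod (of_real (X \<omega>) + z) \<le> 1 * X \<omega> + cmod z"
        using norm_triangle_ineq[of "of_real (X \<omega>)" z] elim by simp
      also have "\<dots> \<le> cmod (1 + z) * X \<omega> + cmod (1 + z)"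
        using 1 2 elim by (intro add_mono mult_right_mono) auto
      finally have "cmod (of_real (X \<omega>) + z) \<le> cmod (1 + z) * (1 + X \<omega>)"
        by (simp add: algebra_simps)
      then have "cmod (of_real (X \<omega>) + z) powr s \<le> (cmod (1 + z) * (1 + X \<omega>)) powr s"
        using s_pos by (intro powr_mono2) auto
      then show ?case
        using elim by (simp add: norm_powr_real_powr' powr_mult)
    qed
  qed (use integrable_shifted_powr[OF z, of s] integrable_1_plus_X in auto)
  finally show ?thesis by simp
qed

text \<open>
  The integral of \<open>g\<close> against the image under \<open>\<omega> \<mapsto> 1 / (1 + X \<omega>)\<close> of the measure with density
  \<open>(1 + X)\<^sup>s\<close>, a finite measure on \<open>[0,1]\<close>.
\<close>

definition weighted :: "(real \<Rightarrow> real) \<Rightarrow> real" where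
  "weighted g = (\<integral>\<omega>. (1 + X \<omega>) powr s * g (1 / (1 + X \<omega>)) \<partial>M)"

lemma integrable_weighted:
  assumes g: "continuous_on UNIV g"
  shows "integrable M (\<lambda>\<omega>. (1 + X \<omega>) powr s * g (1 / (1 + X \<omega>)))"
proof -
  have [measurable]: "g \<in> borel_measurable borel"
    using g by (rule borel_measurable_continuous_onI)
  have "compact (g ` {0..1})"
    using g by (intro compact_continuous_image) (auto intro: continuous_on_subset)
  then have "bounded (g ` {0..1})" by (rule compact_imp_bounded)
  then obtain B where B: "\<And>u. u \<in> {0..1} \<Longrightarrow> \<bar>g u\<bar> \<le> B"
    unfolding bounded_iff by (metis imageI real_norm_def)
  show ?thesis
  proof (rule Bochner_Integration.integrable_bound)
    show "integrable M (\<lambda>\<omega>. (1 + X \<omega>) powr s * B)"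
      using integrable_1_plus_X by simp
    show "AE \<omega> in M. norm ((1 + X \<omega>) powr s * g (1 / (1 + X \<omega>))) \<le> norm ((1 + X \<omega>) powr s * B)"
      using X_nonneg
    proof eventually_elim
      case (elim \<omega>)
      then have "\<bar>g (1 / (1 + X \<omega>))\<bar> \<le> \<bar>B\<bar>"
        using B[of "1 / (1 + X \<omega>)"] by simp
      then show ?case by (simp add: abs_mult mult_left_mono)
    qed
  qed measurable
qed

lemma weighted_polynomial:
  "weighted (\<lambda>u. \<Sum>i\<le>d. c i * u ^ i) = (\<Sum>i\<le>d. c i * (\<integral>\<omega>. (1 + X \<omega>) powr (s - real i) \<partial>M))"
proof -
  have "weighted (\<lambda>u. \<Sum>i\<le>d. c i * u ^ i)
      = (\<integral>\<omega>. (\<Sum>i\<le>d. c i * ((1 + X \<omega>) powr s * (1 / (1 + X \<omega>)) ^ i)) \<partial>M)"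
    by (simp add: weighted_def sum_distrib_left mult_ac)
  also have "\<dots> = (\<Sum>i\<le>d. c i * (\<integral>\<omega>. (1 + X \<omega>) powr s * (1 / (1 + X \<omega>)) ^ i \<partial>M))"
    by (subst Bochner_Integration.integral_sum)
      (auto intro!: integrable_mult_right integrable_weighted continuous_intros)
  also have "\<dots> = (\<Sum>i\<le>d. c i * (\<integral>\<omega>. (1 + X \<omega>) powr (s - real i) \<partial>M))"
  proof (intro sum.cong refl arg_cong2[where f = "(*)"] integral_cong_AE)
    fix i
    show "AE \<omega> in M. (1 + X \<omega>) powr s * (1 / (1 + X \<omega>)) ^ i = (1 + X \<omega>) powr (s - real i)"
      using X_nonneg
      by eventually_elim (simp add: powr_diff powr_realpow power_divide)
  qed measurable
  finally show ?thesis .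
qed

lemma weighted_close:
  assumes g: "continuous_on UNIV g" and p: "continuous_on UNIV p"
    and close: "\<And>u. u \<in> {0..1} \<Longrightarrow> \<bar>g u - p u\<bar> \<le> e"
  shows "\<bar>weighted g - weighted p\<bar> \<le> e * (\<integral>\<omega>. (1 + X \<omega>) powr s \<partial>M)"
proof -
  let ?u = "\<lambda>\<omega>. 1 / (1 + X \<omega>)"
  have "weighted g - weighted p = (\<integral>\<omega>. (1 + X \<omega>) powr s * (g (?u \<omega>) - p (?u \<omega>)) \<partial>M)"
    using integrable_weighted[OF g] integrable_weighted[OF p]
    by (simp add: weighted_def right_diff_distrib)
  then have "\<bar>weighted g - weighted p\<bar>
      \<le> (\<integral>\<omega>. \<bar>(1 + X \<omega>) powr s * (g (?u \<omega>) - p (?u \<omega>))\<bar> \<partial>M)"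
    by (simp only: integral_abs_bound)
  also have "\<dots> \<le> (\<integral>\<omega>. e * (1 + X \<omega>) powr s \<partial>M)"
  proof (rule integral_mono_AE)
    show "integrable M (\<lambda>\<omega>. \<bar>(1 + X \<omega>) powr s * (g (?u \<omega>) - p (?u \<omega>))\<bar>)"
      using g p by (intro integrable_abs integrable_weighted[of "\<lambda>u. g u - p u"] continuous_intros)
    show "AE \<omega> in M. \<bar>(1 + X \<omega>) powr s * (g (?u \<omega>) - p (?u \<omega>))\<bar> \<le> e * (1 + X \<omega>) powr s"
      using X_nonneg
    proof eventually_elim
      case (elim \<omega>)
      then have "\<bar>g (?u \<omega>) - p (?u \<omega>)\<bar> \<le> e" by (intro close) auto
      then show ?case by (simp add: abs_mult mult.commute[of e] mult_left_mono)
    qed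
  qed (use integrable_1_plus_X in simp)
  finally show ?thesis by simp
qed

text \<open>
  At \<open>u = 1/(1 + X)\<close> the factor \<open>u\<^sup>s\<close> cancels the density, and the ramps of slope \<open>j\<close> decrease to the indicator of
  \<open>u \<ge> 1/(1 + c)\<close>, which is the event \<open>X \<le> c\<close>. The absolute value makes the test functions continuous on
  the whole line.
\<close>

lemma weighted_tendsto_prob:
  assumes "0 \<le> c"
  shows "(\<lambda>j. weighted (\<lambda>u. \<bar>u\<bar> powr s * max 0 (min 1 (1 + real j * (u - 1 / (1 + c))))))
    \<longlonglongrightarrow> prob {\<omega> \<in> space M. X \<omega> \<le> c}"
proof -
  define h where "h = (\<lambda>j x. max 0 (min 1 (1 + real j * (1 / (1 + x) - 1 / (1 + c)))))"
  have "weighted (\<lambda>u. \<bar>u\<bar> powr s * max 0 (min 1 (1 + real j * (u - 1 / (1 + c)))))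
      = (\<integral>\<omega>. h j (X \<omega>) \<partial>M)" for j
    unfolding weighted_def
  proof (rule integral_cong_AE)
    show "AE \<omega> in M. (1 + X \<omega>) powr s * (\<bar>1 / (1 + X \<omega>)\<bar> powr s *
        max 0 (min 1 (1 + real j * (1 / (1 + X \<omega>) - 1 / (1 + c))))) = h j (X \<omega>)"
      using X_nonneg by eventually_elim (simp add: h_def powr_divide)
  qed (simp_all add: h_def)
  moreover have "(\<lambda>j. \<integral>\<omega>. h j (X \<omega>) \<partial>M) \<longlonglongrightarrow> (\<integral>\<omega>. indicator {\<omega> \<in> space M. X \<omega> \<le> c} \<omega> \<partial>M)"
  proof (rule integral_dominated_convergence[where w = "\<lambda>_. 1"])
    show "AE \<omega> in M. (\<lambda>j. h j (X \<omega>)) \<longlonglongrightarrow> indicator {\<omega> \<in> space M. X \<omega> \<le> c} \<omega>"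
      using X_nonneg AE_space
    proof eventually_elim
      case (elim \<omega>)
      show ?case
      proof (cases "X \<omega> \<le> c")
        case True
        then have "0 \<le> 1 / (1 + X \<omega>) - 1 / (1 + c)" using elim by (simp add: field_simps)
        then show ?thesis using True elim by (simp add: h_def)
      next
        case False
        define d where "d = 1 / (1 + c) - 1 / (1 + X \<omega>)"
        have "1 / (1 + X \<omega>) < 1 / (1 + c)"
          using False assms by (intro divide_strict_left_mono) auto
        then have "0 < d" by (simp add: d_def)
        obtain J :: nat where J: "1 / d < real J" using reals_Archimedean2 by blast
        have "h j (X \<omega>) = 0" if "J \<le> j" for j
        proof -
          have "1 / d < real j" using J that by simp
          then have "1 + real j * (- d) \<le> 0" using \<open>0 < d\<close> by (simp add: field_simps)
          then show ?thesis by (simp add: h_def d_def)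
        qed
        then show ?thesis
          using False by (intro tendsto_eventually) (auto simp: eventually_sequentially)
      qed
    qed
    show "AE \<omega> in M. norm (h j (X \<omega>)) \<le> 1" for j by (simp add: h_def)
  qed (simp_all add: h_def)
  ultimately show ?thesis by simp
qed

end

section \<open>Determinacy from the moments of \<open>1/(1 + X)\<close>\<close>

text \<open>
  The hypothesis says that the weighted integrals of all monomials agree; Weierstrass approximation on
  \<open>[0,1]\<close> extends this to continuous functions, as both measures are finite.
\<close>

lemma weighted_eq:
  assumes X: "nonneg_power_moment M X s" and Y: "nonneg_power_moment N Y s"
    and eq: "\<And>m::nat. (\<integral>\<omega>. (1 + X \<omega>) powr (s - m) \<partial>M) = (\<integral>\<omega>. (1 + Y \<omega>) powr (s - m) \<partial>N)"
    and g: "continuous_on UNIV g"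
  shows "nonneg_power_moment.weighted M X s g = nonneg_power_moment.weighted N Y s g"
proof -
  interpret X: nonneg_power_moment M X s by (rule X)
  interpret Y: nonneg_power_moment N Y s by (rule Y)
  define I where "I = (\<integral>\<omega>. (1 + X \<omega>) powr s \<partial>M)"
  have I: "I = (\<integral>\<omega>. (1 + Y \<omega>) powr s \<partial>N)" using eq[of 0] by (simp add: I_def)
  have "0 \<le> I" by (simp add: I_def)
  have "\<bar>X.weighted g - Y.weighted g\<bar> \<le> 0 + e" if "0 < e" for e
  proof -
    \<comment> \<open>Both approximation errors are at most \<open>e' I\<close>; adding \<open>1\<close> to \<open>I\<close> avoids a division by zero.\<close>
    define e' where "e' = e / (2 * (I + 1))"
    have "0 < e'" using that \<open>0 \<le> I\<close> by (simp add: e'_def)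
    then obtain p where p: "real_polynomial_function p" "\<And>u. u \<in> {0..1} \<Longrightarrow> \<bar>g u - p u\<bar> < e'"
      using Stone_Weierstrass_real_polynomial_function[of "{0..1}" g e'] continuous_on_subset[OF g]
      by auto
    have pc: "continuous_on UNIV p"
      using p(1) by (simp add: continuous_at_imp_continuous_on continuous_real_polymonial_function)
    obtain c d where p_eq: "p = (\<lambda>u. \<Sum>i\<le>d. c i * u ^ i)"
      using p(1) unfolding real_polynomial_function_iff_sum by auto
    have "X.weighted p = Y.weighted p"
      unfolding p_eq X.weighted_polynomial Y.weighted_polynomial by (simp add: eq)
    moreover have "\<bar>X.weighted g - X.weighted p\<bar> \<le> e' * I"
      unfolding I_def using p(2) by (intro X.weighted_close g pc) (simp add: less_imp_le)
    moreover have "\<bar>Y.weighted g - Y.weighted p\<bar> \<le> e' * I"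
      unfolding I using p(2) by (intro Y.weighted_close g pc) (simp add: less_imp_le)
    ultimately have "\<bar>X.weighted g - Y.weighted g\<bar> \<le> 2 * (e' * I)" by linarith
    also have "\<dots> \<le> e" using that \<open>0 \<le> I\<close> by (simp add: e'_def field_simps)
    finally show ?thesis by simp
  qed
  then have "\<bar>X.weighted g - Y.weighted g\<bar> \<le> 0" by (rule field_le_epsilon)
  then show ?thesis by simp
qed

lemma cdf_eq_of_power_moments:
  assumes X: "nonneg_power_moment M X s" and Y: "nonneg_power_moment N Y s"
    and eq: "\<And>m::nat. (\<integral>\<omega>. (1 + X \<omega>) powr (s - m) \<partial>M) = (\<integral>\<omega>. (1 + Y \<omega>) powr (s - m) \<partial>N)"
  shows "cdf (distr M borel X) = cdf (distr N borel Y)"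
proof
  interpret X: nonneg_power_moment M X s by (rule X)
  interpret Y: nonneg_power_moment N Y s by (rule Y)
  fix c :: real
  have X_cdf: "cdf (distr M borel X) c = X.prob {\<omega> \<in> space M. X \<omega> \<le> c}"
    by (simp add: cdf_def measure_distr vimage_def Int_def conj_commute)
  have Y_cdf: "cdf (distr N borel Y) c = Y.prob {\<omega> \<in> space N. Y \<omega> \<le> c}"
    by (simp add: cdf_def measure_distr vimage_def Int_def conj_commute)
  show "cdf (distr M borel X) c = cdf (distr N borel Y) c"
  proof (cases "0 \<le> c")
    case True
    let ?g = "\<lambda>j u. \<bar>u\<bar> powr s * max 0 (min 1 (1 + real j * (u - 1 / (1 + c))))"
    have "continuous_on UNIV (?g j)" for j
      using X.s_pos by (intro continuous_intros continuous_on_powr') auto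
    then have "X.weighted (?g j) = Y.weighted (?g j)" for j
      by (rule weighted_eq[OF X Y eq])
    then show ?thesis
      using X.weighted_tendsto_prob[OF True] Y.weighted_tendsto_prob[OF True]
      unfolding X_cdf Y_cdf by (auto intro: LIMSEQ_unique)
  next
    case False
    have "X.prob {\<omega> \<in> space M. X \<omega> \<le> c} = 0"
    proof (subst X.prob_eq_0)
      show "AE \<omega> in M. \<omega> \<notin> {\<omega> \<in> space M. X \<omega> \<le> c}"
        using X.X_nonneg by eventually_elim (use False in auto)
    qed measurable
    moreover have "Y.prob {\<omega> \<in> space N. Y \<omega> \<le> c} = 0"
    proof (subst Y.prob_eq_0)
      show "AE \<omega> in N. \<omega> \<notin> {\<omega> \<in> space N. Y \<omega> \<le> c}"
        using Y.X_nonneg by eventually_elim (use False in auto)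
    qed measurable
    ultimately show ?thesis unfolding X_cdf Y_cdf by simp
  qed
qed

section \<open>From a sequence of translations to all exponents\<close>

lemma nonneg_power_momentI:
  assumes "prob_space M" and X [measurable]: "X \<in> borel_measurable M"
    and nonneg: "AE \<omega> in M. 0 \<le> X \<omega>" and "0 < s"
    and fin: "(\<integral>\<^sup>+\<omega>. ennreal (X \<omega> powr s) \<partial>M) < \<infinity>"
  shows "nonneg_power_moment M X s"
proof -
  interpret prob_space M by fact
  have "integrable M (\<lambda>\<omega>. X \<omega> powr s)"
    using fin by (intro integrableI_bounded) auto
  then have dom: "integrable M (\<lambda>\<omega>. 2 powr s * (1 + X \<omega> powr s))" by simp
  have "integrable M (\<lambda>\<omega>. (1 + X \<omega>) powr s)"
  proof (rule Bochner_Integration.integrable_bound[OF dom])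
    show "AE \<omega> in M. norm ((1 + X \<omega>) powr s) \<le> norm (2 powr s * (1 + X \<omega> powr s))"
      using nonneg
    proof eventually_elim
      case (elim \<omega>)
      have "(1 + X \<omega>) powr s \<le> (2 * max 1 (X \<omega>)) powr s"
        using elim \<open>0 < s\<close> by (intro powr_mono2) auto
      also have "\<dots> = 2 powr s * max 1 (X \<omega>) powr s"
        by (simp add: powr_mult)
      also have "max 1 (X \<omega>) powr s \<le> 1 + X \<omega> powr s"
        by (simp add: max_def)
      finally show ?case by (simp add: mult_left_mono)
    qed
  qed measurable
  then show ?thesis
    by unfold_locales (use assms in auto)
qed

text \<open>
  Dividing the difference of the moments by \<open>(1 + z)\<^sup>s\<close>, which has no zero on the half plane, makes it
  bounded without losing any zero, so that \<open>bounded_holomorphic_half_plane_eq_0\<close> applies.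
\<close>

lemma moment_eq_of_moment_at_sequence:
  assumes X: "nonneg_power_moment M X s" and Y: "nonneg_power_moment N Y s"
    and pos: "\<And>k. 1 \<le> k \<Longrightarrow> 0 < a k" and inj: "inj_on a {1..}"
    and lim: "filterlim a at_top sequentially"
    and div: "filterlim (\<lambda>m. \<Sum>k=1..m. 1 / a k) at_top sequentially"
    and eq: "\<And>k. 1 \<le> k \<Longrightarrow>
      nonneg_power_moment.moment M X s (of_real (a k)) = nonneg_power_moment.moment N Y s (of_real (a k))"
    and z: "0 < Re z"
  shows "nonneg_power_moment.moment M X s z = nonneg_power_moment.moment N Y s z"
proof -
  interpret X: nonneg_power_moment M X s by (rule X)
  interpret Y: nonneg_power_moment N Y s by (rule Y)
  define I where "I = (\<integral>\<omega>. (1 + X \<omega>) powr s \<partial>M) + (\<integral>\<omega>. (1 + Y \<omega>) powr s \<partial>N)"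
  define f where "f = (\<lambda>z. (X.moment s z - Y.moment s z) / (1 + z) powr of_real s)"
  have ne: "1 + z \<noteq> 0" if "0 < Re z" for z
    using that by (auto simp: complex_eq_iff)
  have "f z = 0"
  proof (rule bounded_holomorphic_half_plane_eq_0[OF _ _ pos inj lim div _ z])
    have "1 + w \<notin> \<real>\<^sub>\<le>\<^sub>0" if "0 < Re w" for w
      using that by (auto simp: complex_nonpos_Reals_iff)
    then show "f holomorphic_on {z. 0 < Re z}"
      unfolding f_def using ne
      by (intro holomorphic_intros X.holomorphic_on_moment Y.holomorphic_on_moment) auto
    show "cmod (f w) \<le> I" if "0 < Re w" for w
    proof -
      have "cmod (X.moment s w - Y.moment s w) \<le> cmod (1 + w) powr s * I"
        using norm_triangle_ineq4[of "X.moment s w" "Y.moment s w"]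
          X.cmod_moment_le[OF that] Y.cmod_moment_le[OF that]
        by (simp add: I_def distrib_left)
      then show ?thesis
        using ne[OF that] by (simp add: f_def norm_divide norm_powr_real_powr' divide_le_eq mult.commute)
    qed
    show "f (of_real (a k)) = 0" if "1 \<le> k" for k
      using eq[OF that] by (simp add: f_def)
  qed
  then show ?thesis using ne[OF z] by (simp add: f_def)
qed

text \<open>
  Equal functions have equal derivatives, and the derivative of the moment of order \<open>s - m\<close> is
  \<open>s - m\<close> times the moment of order \<open>s - m - 1\<close>. This is where \<open>s\<close> must not be a natural number:
  otherwise the factor would vanish at \<open>m = s\<close>.
\<close>

lemma moment_eq_minus_nat:
  assumes X: "nonneg_power_moment M X s" and Y: "nonneg_power_moment N Y s"
    and s: "s \<notin> \<nat>"
    and eq: "\<And>z. 0 < Re z \<Longrightarrow> nonneg_power_moment.moment M X s z = nonneg_power_moment.moment N Y s z"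
    and z: "0 < Re z"
  shows "nonneg_power_moment.moment M X (s - real m) z = nonneg_power_moment.moment N Y (s - real m) z"
  using z
proof (induction m arbitrary: z)
  case 0
  then show ?case using eq by simp
next
  case (Suc m)
  interpret X: nonneg_power_moment M X s by (rule X)
  interpret Y: nonneg_power_moment N Y s by (rule Y)
  have X': "(X.moment (s - real m) has_field_derivative
      of_real (s - real m) * X.moment (s - real m - 1) z) (at z)"
    using Suc.prems by (intro X.has_field_derivative_moment) auto
  have "(Y.moment (s - real m) has_field_derivative
      of_real (s - real m) * Y.moment (s - real m - 1) z) (at z)"
    using Suc.prems by (intro Y.has_field_derivative_moment) auto
  then have "(X.moment (s - real m) has_field_derivative
      of_real (s - real m) * Y.moment (s - real m - 1) z) (at z)"
    by (rule has_field_derivative_transform_within_open[OF _ open_halfspace_Re_gt[of 0]])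
      (use Suc in auto)
  then have "of_real (s - real m) * X.moment (s - real m - 1) z
      = of_real (s - real m) * Y.moment (s - real m - 1) z"
    using X' by (rule DERIV_unique[THEN sym])
  moreover have "s - real m \<noteq> 0" using s by auto
  ultimately have "X.moment (s - real m - 1) z = Y.moment (s - real m - 1) z"
    by (simp del: of_real_diff)
  then show ?case by (simp add: algebra_simps)
qed

theorem theorem8:
  fixes M :: "'a measure" and N :: "'b measure"
    and X :: "'a \<Rightarrow> real" and Y :: "'b \<Rightarrow> real"
    and n :: nat and s :: real and a :: "nat \<Rightarrow> real"
  assumes "prob_space M" and "X \<in> borel_measurable M" and "AE \<omega> in M. 0 \<le> X \<omega>"
    and "1 \<le> n" and "s \<in> {real n <..< real (n + 1)}"
    and "0 < (\<integral>\<^sup>+\<omega>. ennreal (X \<omega> powr s) \<partial>M)"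
    and "(\<integral>\<^sup>+\<omega>. ennreal (X \<omega> powr s) \<partial>M) < \<infinity>"
    and "\<And>k. 1 \<le> k \<Longrightarrow> 0 < a k" and "inj_on a {1..}"
    and "filterlim a at_top sequentially"
    and "filterlim (\<lambda>m. \<Sum>k=1..m. 1 / a k) at_top sequentially"
    and "prob_space N" and "Y \<in> borel_measurable N" and "AE \<omega> in N. 0 \<le> Y \<omega>"
    and "(\<integral>\<^sup>+\<omega>. ennreal (Y \<omega> powr s) \<partial>N) = (\<integral>\<^sup>+\<omega>. ennreal (X \<omega> powr s) \<partial>M)"
    and "\<And>k. 1 \<le> k \<Longrightarrow> (\<integral>\<^sup>+\<omega>. ennreal ((Y \<omega> + a k) powr s) \<partial>N)
                        = (\<integral>\<^sup>+\<omega>. ennreal ((X \<omega> + a k) powr s) \<partial>M)"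
    and "\<And>k. 1 \<le> k \<Longrightarrow> (\<integral>\<^sup>+\<omega>. ennreal ((Y \<omega> + 2 * a k) powr s) \<partial>N)
                        = (\<integral>\<^sup>+\<omega>. ennreal ((X \<omega> + 2 * a k) powr s) \<partial>M)"
  shows "cdf (distr N borel Y) = cdf (distr M borel X)"
proof -
  have "0 < s" using assms(4,5) by auto
  have X: "nonneg_power_moment M X s"
    using assms(1-3,7) \<open>0 < s\<close> by (intro nonneg_power_momentI)
  have Y: "nonneg_power_moment N Y s"
    using assms(7,12-15) \<open>0 < s\<close> by (intro nonneg_power_momentI) auto
  interpret X: nonneg_power_moment M X s by (rule X)
  interpret Y: nonneg_power_moment N Y s by (rule Y)
  have "s \<notin> \<nat>"
  proof
    assume "s \<in> \<nat>"
    then obtain k where "s = real k" by (auto elim: Nats_cases)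
    then show False using assms(5) by auto
  qed
  have "X.moment s (of_real (a k)) = Y.moment s (of_real (a k))" if "1 \<le> k" for k
    using assms(8)[OF that] assms(16)[OF that]
    by (simp add: X.moment_of_real Y.moment_of_real integral_eq_nn_integral)
  then have "X.moment s z = Y.moment s z" if "0 < Re z" for z
    using moment_eq_of_moment_at_sequence[OF X Y assms(8-11) _ that] by blast
  then have "X.moment (s - real m) 1 = Y.moment (s - real m) 1" for m
    using moment_eq_minus_nat[OF X Y \<open>s \<notin> \<nat>\<close>, of 1 m] by simp
  then have "(\<integral>\<omega>. (1 + X \<omega>) powr (s - real m) \<partial>M) = (\<integral>\<omega>. (1 + Y \<omega>) powr (s - real m) \<partial>N)" for m
    using X.moment_of_real[of 1 "s - real m"] Y.moment_of_real[of 1 "s - real m"]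
    by (simp add: add.commute)
  then show ?thesis
    by (rule cdf_eq_of_power_moments[OF X Y, symmetric])
qed

end
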